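(* The $(3,6)$-spectrum is the set of all even integers greater than or equal to $14$, that is, $\{14,16,18,20,\dots\}$. Its first element $14$ is equal both to $N(3,6)$ and to the Moore bound $M(3,6)$.
   Context: Graphs are finite and simple. For integers $k\ge 3$, $g\ge 3$, a $(k,g)$-graph is a $k$-regular graph of girth exactly $g$. The $(k,g)$-spectrum is the set of all integers $n$ such that there exists a connected $(k,g)$-graph of order $n$. For odd $k$, $N(k,g)$ denotes the smallest element $N$ of the $(k,g)$-spectrum such that all even integers $n\ge N$ belong to the $(k,g)$-spectrum. The Moore bound is $M(k,g)=1+\sum_{i=0}^{(g-3)/2}k(k-1)^i$ for $g$ odd and $M(k,g)=2\sum_{i=0}^{(g-2)/2}(k-1)^i$ for $g$ even. *)

theory Defs
  imports "Graph_Theory.Graph_Theory"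
begin

text \<open>
  A finite simple graph is a \<open>pair_graph\<close>: a finite vertex set together with a finite, symmetric,
  irreflexive set of ordered pairs of vertices. Each undirected edge is present as two opposite arcs,
  so the degree of a vertex is its out-degree.

  For the same reason \<open>u, v, u\<close> is a directed cycle of length 2 as soon as \<open>u\<close> and \<open>v\<close> are
  adjacent; the cycles of the undirected graph are exactly the directed cycles of length at least 3.
\<close>

definition regular :: "nat \<Rightarrow> 'a pair_pre_digraph \<Rightarrow> bool" where
  "regular k G \<longleftrightarrow> (\<forall>v \<in> pverts G. out_degree (with_proj G) v = k)"

text \<open>The girth of an acyclic graph is \<open>\<infinity>\<close>, the infimum of the empty set.\<close>

definition girth :: "'a pair_pre_digraph \<Rightarrow> enat" where
  "girth G = (INF p \<in> {p. pre_digraph.cycle (with_proj G) p \<and> 3 \<le> length p}. enat (length p))"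

definition kg_graph :: "nat \<Rightarrow> nat \<Rightarrow> 'a pair_pre_digraph \<Rightarrow> bool" where
  "kg_graph k g G \<longleftrightarrow> pair_graph G \<and> regular k G \<and> girth G = enat g"

text \<open>
  Vertices are taken from \<^typ>\<open>nat\<close>; every finite graph is isomorphic to such a graph.
  The library's notion of connectedness requires at least one vertex.
\<close>

definition kg_spectrum :: "nat \<Rightarrow> nat \<Rightarrow> nat set" where
  "kg_spectrum k g =
     {n. \<exists>G :: nat pair_pre_digraph.
           kg_graph k g G \<and> Digraph_Component.connected (with_proj G) \<and> card (pverts G) = n}"

text \<open>Meaningful only for odd \<open>k\<close>, and only if some \<open>N\<close> as described exists.\<close>

definition spectrum_N :: "nat \<Rightarrow> nat \<Rightarrow> nat" where
  "spectrum_N k g =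
     (LEAST N. N \<in> kg_spectrum k g \<and> (\<forall>n \<ge> N. even n \<longrightarrow> n \<in> kg_spectrum k g))"

definition moore_bound :: "nat \<Rightarrow> nat \<Rightarrow> nat" where
  "moore_bound k g =
     (if odd g then 1 + (\<Sum>i = 0..(g - 3) div 2. k * (k - 1) ^ i)
      else 2 * (\<Sum>i = 0..(g - 2) div 2. (k - 1) ^ i))"

end

theory Submission
  imports Defs
begin

text \<open>
  Lower bound. Let \<open>u v\<close> be an edge of a cubic graph of girth at least 6. Call the set of all
  neighbours of neighbours of \<open>u\<close> the second neighbourhood of \<open>u\<close>; it contains \<open>u\<close> itself.
  The three neighbours of \<open>u\<close> have two further neighbours each, and these are six different
  vertices because there is no 4-cycle, so the second neighbourhood has \<open>1 + 3 * 2 = 7\<close> elements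
  (\<open>card_second_neighbourhood\<close>). The second neighbourhoods of \<open>u\<close> and of \<open>v\<close> are disjoint, as a
  common element would close a walk of length 5 through the edge \<open>u v\<close>. Hence there are at least
  14 vertices (\<open>order_ge_if_girth_ge_6\<close>). Their number is even by the handshake argument
  (\<open>regular_imp_even_mult_card\<close>).

  Construction. For even \<open>n \<ge> 14\<close> take the residues modulo \<open>n\<close> as vertices and join every even
  \<open>x\<close> to the odd vertices \<open>x - 1\<close>, \<open>x + 1\<close> and \<open>x + 5\<close>. The graph is bipartite, so it has no
  closed walk of odd length. A 4-cycle would give steps \<open>p, q, r, s\<close> in \<open>{-1, 1, 5}\<close> with
  \<open>p + r = q + s\<close> modulo \<open>n\<close>. Both sides lie between -2 and 10, so for \<open>n \<ge> 14\<close> this is an equality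
  of integers, and \<open>{-1, 1, 5}\<close> is a Sidon set: equal sums have equal summands, and the 4-cycle
  degenerates. A 6-cycle is easily exhibited, and the steps \<open>x, x + 1\<close> make the graph connected.
\<close>

section \<open>Girth at least six\<close>

lemma girth_le_cycle_length:
  assumes "pre_digraph.cycle (with_proj G) p" "3 \<le> length p"
  shows "girth G \<le> enat (length p)"
  unfolding girth_def by (rule INF_lower) (use assms in simp)

lemma cycle_with_proj_iff:
  "pre_digraph.cycle (with_proj G) p \<longleftrightarrow>
     (\<exists>u \<in> pverts G. set p \<subseteq> parcs G \<and> pcas u p u \<and> distinct (tl (pawalk_verts u p)) \<and> p \<noteq> [])"
  by (auto simp: pre_digraph.cycle_def pre_digraph.awalk_def cas_with_proj_eq
      awalk_verts_with_proj_eq)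

text \<open>
  This form avoids lists of arcs and distinctness conditions. Closed walks of length 3 in a loopless
  graph are automatically cycles. A closed walk of length 5 that repeats a vertex contains a
  triangle, so once triangles are excluded it is a cycle too. Only for length 4 do degenerate
  closed walks have to be allowed.
\<close>

lemma girth_ge_6_iff:
  assumes "pair_graph G"
  shows "6 \<le> girth G \<longleftrightarrow>
    (\<forall>a b c. (a, b) \<in> parcs G \<longrightarrow> (b, c) \<in> parcs G \<longrightarrow> (c, a) \<notin> parcs G) \<and>
    (\<forall>a b c d. (a, b) \<in> parcs G \<longrightarrow> (b, c) \<in> parcs G \<longrightarrow> (c, d) \<in> parcs G \<longrightarrow> (d, a) \<in> parcs G
       \<longrightarrow> a = c \<or> b = d) \<and>
    (\<forall>a b c d e. (a, b) \<in> parcs G \<longrightarrow> (b, c) \<in> parcs G \<longrightarrow> (c, d) \<in> parcs G \<longrightarrow> (d, e) \<in> parcs G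
       \<longrightarrow> (e, a) \<notin> parcs G)"
    (is "_ \<longleftrightarrow> ?no3 \<and> ?no4 \<and> ?no5")
proof -
  interpret pair_graph G by (fact assms)
  have loopless: "u \<noteq> v" if "(u, v) \<in> parcs G" for u v
    using that by (rule no_loops')
  show ?thesis
  proof
    assume girth: "6 \<le> girth G"
    have long: False if "pre_digraph.cycle (with_proj G) p" "3 \<le> length p" "length p \<le> 5" for p
    proof -
      have "6 \<le> enat (length p)"
        using girth girth_le_cycle_length[OF that(1,2)] by (rule order_trans)
      then show False
        using that(3) by (simp add: numeral_eq_enat)
    qed
    have no3: ?no3
    proof (intro allI impI notI)
      fix a b c
      assume arcs: "(a, b) \<in> parcs G" "(b, c) \<in> parcs G" "(c, a) \<in> parcs G"
      with arcs arcs[THEN loopless] have "pre_digraph.cycle (with_proj G) [(a, b), (b, c), (c, a)]"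
        using in_arcsD1[OF arcs(1)] unfolding cycle_with_proj_iff
        by (intro bexI[of _ a]) auto
      then show False by (rule long) auto
    qed
    moreover have ?no4
    proof (intro allI impI, rule ccontr)
      fix a b c d
      assume arcs: "(a, b) \<in> parcs G" "(b, c) \<in> parcs G" "(c, d) \<in> parcs G" "(d, a) \<in> parcs G"
        and "\<not> (a = c \<or> b = d)"
      with arcs arcs[THEN loopless] have "pre_digraph.cycle (with_proj G) [(a, b), (b, c), (c, d), (d, a)]"
        using in_arcsD1[OF arcs(1)] unfolding cycle_with_proj_iff
        by (intro bexI[of _ a]) auto
      then show False by (rule long) auto
    qed
    moreover have ?no5
    proof (intro allI impI notI)
      fix a b c d e
      assume arcs: "(a, b) \<in> parcs G" "(b, c) \<in> parcs G" "(c, d) \<in> parcs G" "(d, e) \<in> parcs G"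
        "(e, a) \<in> parcs G"
      \<comment> \<open>If two non-consecutive vertices of the walk coincide, a triangle splits off.\<close>
      have "a \<noteq> c" "b \<noteq> d" "c \<noteq> e" "d \<noteq> a" "e \<noteq> b"
        using no3 arcs by blast+
      with arcs arcs[THEN loopless]
      have "pre_digraph.cycle (with_proj G) [(a, b), (b, c), (c, d), (d, e), (e, a)]"
        using in_arcsD1[OF arcs(1)] unfolding cycle_with_proj_iff
        by (intro bexI[of _ a]) auto
      then show False by (rule long) auto
    qed
    ultimately show "?no3 \<and> ?no4 \<and> ?no5" by blast
  next
    assume free: "?no3 \<and> ?no4 \<and> ?no5"
    have "6 \<le> enat (length p)"
      if cyc: "pre_digraph.cycle (with_proj G) p" and len: "3 \<le> length p" for p
    proof (rule ccontr)
      assume "\<not> 6 \<le> enat (length p)"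
      with len have "length p = 3 \<or> length p = 4 \<or> length p = 5"
        by (auto simp: numeral_eq_enat)
      then show False
      proof (elim disjE)
        assume "length p = 3"
        then obtain e1 e2 e3 where "p = [e1, e2, e3]"
          by (auto simp: eval_nat_numeral length_Suc_conv)
        with cyc obtain a b c where p: "p = [(a, b), (b, c), (c, a)]"
          by (cases e1; cases e2; cases e3) (auto simp: cycle_with_proj_iff)
        from cyc have "(a, b) \<in> parcs G" "(b, c) \<in> parcs G" "(c, a) \<in> parcs G"
          by (simp_all add: cycle_with_proj_iff p)
        with free show False by blast
      next
        assume "length p = 4"
        then obtain e1 e2 e3 e4 where "p = [e1, e2, e3, e4]"
          by (auto simp: eval_nat_numeral length_Suc_conv)
        with cyc obtain a b c d where p: "p = [(a, b), (b, c), (c, d), (d, a)]"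
          by (cases e1; cases e2; cases e3; cases e4) (auto simp: cycle_with_proj_iff)
        from cyc have "a \<noteq> c" "b \<noteq> d" "(a, b) \<in> parcs G" "(b, c) \<in> parcs G" "(c, d) \<in> parcs G" "(d, a) \<in> parcs G"
          by (auto simp: cycle_with_proj_iff p)
        with free show False by blast
      next
        assume "length p = 5"
        then obtain e1 e2 e3 e4 e5 where "p = [e1, e2, e3, e4, e5]"
          by (auto simp: eval_nat_numeral length_Suc_conv)
        with cyc obtain a b c d e where p: "p = [(a, b), (b, c), (c, d), (d, e), (e, a)]"
          by (cases e1; cases e2; cases e3; cases e4; cases e5) (auto simp: cycle_with_proj_iff)
        from cyc have "(a, b) \<in> parcs G" "(b, c) \<in> parcs G" "(c, d) \<in> parcs G" "(d, e) \<in> parcs G" "(e, a) \<in> parcs G"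
          by (simp_all add: cycle_with_proj_iff p)
        with free show False by blast
      qed
    qed
    then show "6 \<le> girth G"
      unfolding girth_def by (intro INF_greatest) auto
  qed
qed

lemma
  assumes "pair_graph G" "6 \<le> girth G"
  shows no_4_cycle_if_girth_ge_6:
      "\<lbrakk>(a, b) \<in> parcs G; (b, c) \<in> parcs G; (c, d) \<in> parcs G; (d, a) \<in> parcs G\<rbrakk>
        \<Longrightarrow> a = c \<or> b = d"
    and no_5_walk_if_girth_ge_6:
      "\<lbrakk>(a, b) \<in> parcs G; (b, c) \<in> parcs G; (c, d) \<in> parcs G; (d, e) \<in> parcs G\<rbrakk>
        \<Longrightarrow> (e, a) \<notin> parcs G"
  using assms(2) unfolding girth_ge_6_iff[OF assms(1)] by blast+

section \<open>The order of a cubic graph of girth six\<close>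

lemma out_degree_with_proj: "out_degree (with_proj G) v = card {w. (v, w) \<in> parcs G}"
proof -
  have "out_arcs (with_proj G) v = Pair v ` {w. (v, w) \<in> parcs G}"
    by (auto simp: out_arcs_def)
  then show ?thesis
    by (simp add: out_degree_def card_image inj_on_def)
qed

text \<open>
  The handshake argument: \<open>k * card (pverts G)\<close> counts the arcs, and reversal pairs them up. The
  linear order on the vertices only serves to pick one arc from each pair.
\<close>

lemma regular_imp_even_mult_card:
  fixes G :: "'a::linorder pair_pre_digraph"
  assumes "pair_graph G" "regular k G"
  shows "even (k * card (pverts G))"
proof -
  interpret pair_graph G by (fact assms)
  let ?up = "{e \<in> parcs G. fst e < snd e}" and ?down = "{e \<in> parcs G. snd e < fst e}"
  have "parcs G = (SIGMA v:pverts G. {w. (v, w) \<in> parcs G})"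
    by (auto dest: in_arcsD1)
  then have "card (parcs G) = card (SIGMA v:pverts G. {w. (v, w) \<in> parcs G})"
    by simp
  also have "\<dots> = (\<Sum>v\<in>pverts G. card {w. (v, w) \<in> parcs G})"
  proof (rule card_SigmaI)
    show "finite (pverts G)" by (rule pair_finite_verts)
    show "\<forall>v\<in>pverts G. finite {w. (v, w) \<in> parcs G}"
      by (auto intro: finite_subset[OF _ pair_finite_verts] dest: in_arcsD2)
  qed
  also have "\<dots> = k * card (pverts G)"
    using assms(2) by (simp add: regular_def out_degree_with_proj)
  finally have arcs: "card (parcs G) = k * card (pverts G)" .
  have "?down = prod.swap ` ?up"
    by (auto simp: image_iff intro: arcs_symmetric)
  then have "card ?down = card ?up"
    by (simp add: card_image)
  moreover have "e \<in> ?up \<union> ?down" if "e \<in> parcs G" for e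
    using that pair_no_loops[OF that] by (auto simp: neq_iff)
  then have "parcs G = ?up \<union> ?down"
    by blast
  then have "card (parcs G) = card (?up \<union> ?down)"
    by simp
  moreover have "card (?up \<union> ?down) = card ?up + card ?down"
    using pair_finite_arcs by (intro card_Un_disjoint) auto
  ultimately show ?thesis
    using arcs by simp
qed

text \<open>
  Without 4-cycles, two different neighbours of \<open>u\<close> have no common neighbour besides \<open>u\<close>.
\<close>

lemma card_second_neighbourhood:
  assumes "pair_graph G" "regular k G" "6 \<le> girth G" "u \<in> pverts G" "0 < k"
  shows "card (\<Union>w \<in> {w. (u, w) \<in> parcs G}. {x. (w, x) \<in> parcs G}) = 1 + k * (k - 1)"
proof -
  interpret pair_graph G by (fact assms)
  let ?N = "\<lambda>w. {x. (w, x) \<in> parcs G}"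
  have fin: "finite (?N w)" for w
    by (rule finite_subset[OF _ pair_finite_verts]) (auto dest: in_arcsD2)
  have deg: "card (?N w) = k" if "w \<in> pverts G" for w
    using assms(2) that by (simp add: regular_def out_degree_with_proj)
  obtain w where w: "(u, w) \<in> parcs G"
    using deg[OF assms(4)] assms(5) by (metis Collect_empty_eq card.empty less_irrefl)
  have "(\<Union>w\<in>?N u. ?N w) = insert u (\<Union>w\<in>?N u. ?N w - {u})"
    using w arcs_symmetric[OF w] by blast
  also have "card \<dots> = 1 + card (\<Union>w\<in>?N u. ?N w - {u})"
    using fin by (intro trans[OF card_insert_disjoint]) auto
  also have "card (\<Union>w\<in>?N u. ?N w - {u}) = (\<Sum>w\<in>?N u. card (?N w - {u}))"
  proof (rule card_UN_disjoint)
    have False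
      if "w \<in> ?N u" "w' \<in> ?N u" "w \<noteq> w'" "x \<in> ?N w - {u}" "x \<in> ?N w' - {u}" for w w' x
      using no_4_cycle_if_girth_ge_6[OF assms(1,3), of u w x w'] that
        arcs_symmetric[of w' x] arcs_symmetric[of u w'] by simp
    then show "\<forall>w\<in>?N u. \<forall>w'\<in>?N u. w \<noteq> w' \<longrightarrow> (?N w - {u}) \<inter> (?N w' - {u}) = {}"
      by blast
  qed (use fin in auto)
  also have "\<dots> = (\<Sum>w\<in>?N u. k - 1)"
  proof (rule sum.cong)
    fix w assume "w \<in> ?N u"
    then have "(w, u) \<in> parcs G" by (simp add: arcs_symmetric)
    then show "card (?N w - {u}) = k - 1"
      using deg[OF in_arcsD1] by (simp add: card_Diff_singleton)
  qed simp
  also have "\<dots> = k * (k - 1)"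
    using deg[OF assms(4)] by simp
  finally show ?thesis .
qed

text \<open>
  The bound is \<open>moore_bound k 6\<close>: if \<open>x\<close> is reached from \<open>u\<close> through \<open>a\<close> and from an adjacent \<open>v\<close>
  through \<open>b\<close>, then \<open>u, a, x, b, v\<close> is a closed walk of length 5, so the two second neighbourhoods
  are disjoint.
\<close>

lemma order_ge_if_girth_ge_6:
  assumes "pair_graph G" "regular k G" "6 \<le> girth G" "pverts G \<noteq> {}" "0 < k"
  shows "2 * (1 + k * (k - 1)) \<le> card (pverts G)"
proof -
  interpret pair_graph G by (fact assms)
  let ?S = "\<lambda>u. \<Union>w \<in> {w. (u, w) \<in> parcs G}. {x. (w, x) \<in> parcs G}"
  obtain u where u: "u \<in> pverts G"
    using assms(4) by auto
  then have "card {w. (u, w) \<in> parcs G} = k"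
    using assms(2) by (simp add: regular_def out_degree_with_proj)
  then obtain v where uv: "(u, v) \<in> parcs G"
    using assms(5) by (metis Collect_empty_eq card.empty less_irrefl)
  then have v: "v \<in> pverts G" by (rule in_arcsD2)
  have False if "(u, a) \<in> parcs G" "(a, x) \<in> parcs G" "(v, b) \<in> parcs G" "(b, x) \<in> parcs G" for a b x
    using no_5_walk_if_girth_ge_6[OF assms(1,3) that(1,2) arcs_symmetric[OF that(4)]
        arcs_symmetric[OF that(3)]] arcs_symmetric[OF uv] by blast
  then have "?S u \<inter> ?S v = {}"
    by blast
  moreover have sub: "?S w \<subseteq> pverts G" for w
    by (auto dest: in_arcsD2)
  ultimately have "card (?S u) + card (?S v) = card (?S u \<union> ?S v)"
    by (intro card_Un_disjoint[symmetric] finite_subset[OF _ pair_finite_verts])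
  also have "\<dots> \<le> card (pverts G)"
    using sub by (intro card_mono pair_finite_verts Un_least)
  finally show ?thesis
    using card_second_neighbourhood[OF assms(1-3) u assms(5)]
      card_second_neighbourhood[OF assms(1-3) v assms(5)] by simp
qed

section \<open>A cubic bipartite circulant\<close>

text \<open>
  The graph with LCF notation \<open>[5, -5]^(n/2)\<close>; for \<open>n = 14\<close> it is the Heawood graph. The relation
  \<open>heawood_arc\<close> orients every edge from its even to its odd end, so that the two colour classes and
  the sign of the steps remain visible. Parity is compatible with reduction modulo \<open>n\<close> only for
  even \<open>n\<close>.
\<close>

definition heawood_arc :: "nat \<Rightarrow> nat \<Rightarrow> nat \<Rightarrow> bool" where
  "heawood_arc n x y \<longleftrightarrow> x < n \<and> y < n \<and> even x \<and> odd y \<and>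
     (\<exists>d \<in> {- 1, 1, 5}. int n dvd int y - (int x + d))"

definition heawood :: "nat \<Rightarrow> nat pair_pre_digraph" where
  "heawood n = \<lparr>pverts = {..<n}, parcs = {(x, y). heawood_arc n x y \<or> heawood_arc n y x}\<rparr>"

lemma pair_graph_heawood: "pair_graph (heawood n)"
proof
  show "finite (parcs (heawood n))"
    by (rule finite_subset[of _ "{..<n} \<times> {..<n}"]) (auto simp: heawood_def heawood_arc_def)
  show "symmetric (with_proj (heawood n))"
    by (auto simp: symmetric_def heawood_def intro: symI)
qed (auto simp: heawood_def heawood_arc_def)

lemma card_residues:
  fixes D :: "int set"
  assumes "0 < n" "\<And>d d'. d \<in> D \<Longrightarrow> d' \<in> D \<Longrightarrow> int n dvd d - d' \<Longrightarrow> d = d'"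
  shows "card {y. y < n \<and> (\<exists>d\<in>D. int n dvd int y - d)} = card D"
proof -
  have "{y. y < n \<and> (\<exists>d\<in>D. int n dvd int y - d)} = (\<lambda>d. nat (d mod int n)) ` D"
  proof (intro equalityI subsetI)
    fix y assume "y \<in> {y. y < n \<and> (\<exists>d\<in>D. int n dvd int y - d)}"
    then obtain d where "d \<in> D" "y < n" "int n dvd int y - d" by auto
    then have "d mod int n = int y"
      by (metis mod_eq_dvd_iff mod_pos_pos_trivial of_nat_0_le_iff of_nat_less_iff)
    with \<open>d \<in> D\<close> show "y \<in> (\<lambda>d. nat (d mod int n)) ` D"
      by (metis image_eqI nat_int)
  next
    fix y assume "y \<in> (\<lambda>d. nat (d mod int n)) ` D"
    then obtain d where "d \<in> D" "y = nat (d mod int n)" by auto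
    with assms(1) have "int y = d mod int n" by simp
    then have "int y < int n" "int n dvd int y - d"
      using assms(1) by (simp_all flip: mod_eq_dvd_iff)
    then have "y < n" "int n dvd int y - d" by simp_all
    with \<open>d \<in> D\<close> show "y \<in> {y. y < n \<and> (\<exists>d\<in>D. int n dvd int y - d)}" by auto
  qed
  moreover have "inj_on (\<lambda>d. nat (d mod int n)) D"
  proof (rule inj_onI)
    fix d d' assume "d \<in> D" "d' \<in> D" "nat (d mod int n) = nat (d' mod int n)"
    with assms(1) have "d mod int n = d' mod int n" by (simp add: nat_eq_iff)
    with assms(2) \<open>d \<in> D\<close> \<open>d' \<in> D\<close> show "d = d'" by (simp add: mod_eq_dvd_iff)
  qed
  ultimately show ?thesis by (simp add: card_image)
qed

lemma eq_if_dvd_diff_small: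
  fixes k l :: int
  assumes "int n dvd k - l" "\<bar>k - l\<bar> < int n"
  shows "k = l"
  using assms dvd_imp_le_int[of "k - l" "int n"] by fastforce

lemma regular_heawood:
  assumes "even n" "14 \<le> n"
  shows "regular 3 (heawood n)"
  unfolding regular_def out_degree_with_proj
proof
  fix v assume "v \<in> pverts (heawood n)"
  then have v: "v < n" by (simp add: heawood_def)
  have parity: "even (int y - e)" if "int n dvd int y - e" for y e
    using assms(1) that by (meson dvd_trans even_of_nat_iff)
  \<comment> \<open>The steps from an odd vertex are the negatives of the steps from an even one.\<close>
  define D :: "int set" where
    "D = (if even v then (\<lambda>t. int v + t) ` {- 1, 1, 5} else (\<lambda>t. int v - t) ` {- 1, 1, 5})"
  have "(v, w) \<in> parcs (heawood n) \<longleftrightarrow> w < n \<and> (\<exists>d\<in>D. int n dvd int w - d)" for w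
  proof (cases "even v")
    case True
    have D: "(\<exists>d\<in>D. int n dvd int w - d) \<longleftrightarrow> (\<exists>t\<in>{- 1, 1, 5}. int n dvd int w - (int v + t))"
      unfolding D_def if_P[OF True] by (rule bex_simps(7))
    have "odd w" if "t \<in> {- 1, 1, 5}" "int n dvd int w - (int v + t)" for t
      using parity[OF that(2)] that(1) True by auto
    then have "heawood_arc n v w \<longleftrightarrow> w < n \<and> (\<exists>d\<in>D. int n dvd int w - d)"
      unfolding D heawood_arc_def using True v by blast
    moreover have "\<not> heawood_arc n w v"
      using True by (simp add: heawood_arc_def)
    ultimately show ?thesis
      by (simp add: heawood_def)
  next
    case False
    have D: "(\<exists>d\<in>D. int n dvd int w - d) \<longleftrightarrow> (\<exists>t\<in>{- 1, 1, 5}. int n dvd int w - (int v - t))"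
      unfolding D_def if_not_P[OF False] by (rule bex_simps(7))
    have swap: "int n dvd int v - (int w + t) \<longleftrightarrow> int n dvd int w - (int v - t)" for t
      using dvd_diff_commute[of "int n" "int v" "int w + t"] by (simp add: algebra_simps)
    have "even w" if "t \<in> {- 1, 1, 5}" "int n dvd int w - (int v - t)" for t
      using parity[OF that(2)] that(1) False by auto
    then have "heawood_arc n w v \<longleftrightarrow> w < n \<and> (\<exists>d\<in>D. int n dvd int w - d)"
      unfolding D heawood_arc_def swap using False v by blast
    moreover have "\<not> heawood_arc n v w"
      using False by (simp add: heawood_arc_def)
    ultimately show ?thesis
      by (simp add: heawood_def)
  qed
  then have "{w. (v, w) \<in> parcs (heawood n)} = {w. w < n \<and> (\<exists>d\<in>D. int n dvd int w - d)}"
    by blast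
  also have "card \<dots> = card D"
  proof (rule card_residues)
    show "0 < n" using assms(2) by simp
    fix d d' assume d: "d \<in> D" "d' \<in> D" "int n dvd d - d'"
    then have "\<bar>d - d'\<bar> < int n" using assms(2) by (auto simp: D_def split: if_splits)
    with d(3) show "d = d'" by (rule eq_if_dvd_diff_small)
  qed
  also have "card D = 3" by (simp add: D_def)
  finally show "card {w. (v, w) \<in> parcs (heawood n)} = 3" .
qed

text \<open>
  The congruence \<open>p + r = q + s\<close> between steps is an equality of integers because the two sides
  differ by at most 12. In the Sidon set \<open>{-1, 1, 5}\<close> it forces \<open>p = q\<close> or \<open>p = s\<close>.
\<close>

lemma heawood_no_4_cycle:
  assumes "14 \<le> n" "heawood_arc n a b" "heawood_arc n c b" "heawood_arc n c d" "heawood_arc n a d"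
  shows "a = c \<or> b = d"
proof -
  obtain p q r s where steps: "p \<in> {- 1, 1, 5}" "q \<in> {- 1, 1, 5}" "r \<in> {- 1, 1, 5}" "s \<in> {- 1, 1, 5}"
    and dvd: "int n dvd int b - (int a + p)" "int n dvd int b - (int c + q)"
      "int n dvd int d - (int c + r)" "int n dvd int d - (int a + s)"
    using assms(2-5) unfolding heawood_arc_def by metis
  have "int n dvd ((int b - (int c + q)) - (int b - (int a + p))) +
      ((int d - (int a + s)) - (int d - (int c + r)))"
    by (intro dvd_add dvd_diff dvd)
  then have "int n dvd (p + r) - (q + s)" by (simp add: algebra_simps)
  moreover have "\<bar>(p + r) - (q + s)\<bar> < int n"
  proof -
    have "- 1 \<le> t \<and> t \<le> 5" if "t \<in> {- 1, 1, 5}" for t :: int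
      using that by auto
    from this[OF steps(1)] this[OF steps(2)] this[OF steps(3)] this[OF steps(4)] assms(1)
    show ?thesis by linarith
  qed
  ultimately have "p + r = q + s"
    by (rule eq_if_dvd_diff_small)
  with steps have "p = q \<or> p = s"
    by (simp only: insert_iff empty_iff) presburger
  then show ?thesis
  proof
    assume "p = q"
    then have "int n dvd int a - int c"
      using dvd_diff[OF dvd(2,1)] by simp
    moreover have "a < n" "c < n" using assms(2,3) by (simp_all add: heawood_arc_def)
    ultimately show ?thesis
      using eq_if_dvd_diff_small[of n "int a" "int c"] by linarith
  next
    assume "p = s"
    then have "int n dvd int b - int d"
      using dvd_diff[OF dvd(4,1)] by (simp add: dvd_diff_commute)
    moreover have "b < n" "d < n" using assms(2,4) by (simp_all add: heawood_arc_def)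
    ultimately show ?thesis
      using eq_if_dvd_diff_small[of n "int b" "int d"] by linarith
  qed
qed

lemma girth_heawood:
  assumes "14 \<le> n"
  shows "girth (heawood n) = 6"
proof (rule antisym)
  \<comment> \<open>Forward and backward steps alternate, and each of +1, -1, +5 is taken once in either
    direction, so that they sum to 0 without wrapping around modulo \<open>n\<close>.\<close>
  let ?p = "[(0, 1), (1, 2), (2, 7), (7, 6), (6, 5), (5, 0)]"
  have "heawood_arc n 0 1" "heawood_arc n 2 1" "heawood_arc n 2 7"
    "heawood_arc n 6 7" "heawood_arc n 6 5" "heawood_arc n 0 5"
    using assms by (simp_all add: heawood_arc_def)
  then have "pre_digraph.cycle (with_proj (heawood n)) ?p"
    using assms unfolding cycle_with_proj_iff
    by (intro bexI[of _ 0]) (simp_all add: heawood_def)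
  from girth_le_cycle_length[OF this] have "girth (heawood n) \<le> enat 6"
    by (simp add: eval_nat_numeral)
  then show "girth (heawood n) \<le> 6"
    by (simp add: numeral_eq_enat)
  have bip: "even x \<longleftrightarrow> odd y" if "(x, y) \<in> parcs (heawood n)" for x y
    using that by (auto simp: heawood_def heawood_arc_def)
  show "6 \<le> girth (heawood n)"
    unfolding girth_ge_6_iff[OF pair_graph_heawood]
  proof (intro conjI allI impI notI)
    fix a b c d
    assume arcs: "(a, b) \<in> parcs (heawood n)" "(b, c) \<in> parcs (heawood n)"
      "(c, d) \<in> parcs (heawood n)" "(d, a) \<in> parcs (heawood n)"
    show "a = c \<or> b = d"
    proof (cases "even a")
      case True
      with arcs have "heawood_arc n a b" "heawood_arc n c b" "heawood_arc n c d" "heawood_arc n a d"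
        by (auto simp: heawood_def heawood_arc_def)
      with assms show ?thesis by (rule heawood_no_4_cycle)
    next
      case False
      with arcs have "heawood_arc n b a" "heawood_arc n d a" "heawood_arc n d c" "heawood_arc n b c"
        by (auto simp: heawood_def heawood_arc_def)
      with heawood_no_4_cycle[OF assms this] show ?thesis by blast
    qed
  next
    fix a b c
    assume "(a, b) \<in> parcs (heawood n)" "(b, c) \<in> parcs (heawood n)"
      "(c, a) \<in> parcs (heawood n)"
    from this[THEN bip] show False by blast
  next
    fix a b c d e
    assume "(a, b) \<in> parcs (heawood n)" "(b, c) \<in> parcs (heawood n)"
      "(c, d) \<in> parcs (heawood n)" "(d, e) \<in> parcs (heawood n)" "(e, a) \<in> parcs (heawood n)"
    from this[THEN bip] show False by blast
  qed
qed

lemma connected_heawood: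
  assumes "14 \<le> n"
  shows "Digraph_Component.connected (with_proj (heawood n))"
proof -
  interpret pair_graph "heawood n" by (rule pair_graph_heawood)
  let ?G = "with_proj (heawood n)"
  have from0: "0 \<rightarrow>\<^sup>*\<^bsub>?G\<^esub> x" if "x < n" for x
    using that
  proof (induction x)
    case 0
    then have "0 \<in> pverts (heawood n)" by (simp add: heawood_def)
    then show ?case by (rule reachable_refl)
  next
    case (Suc x)
    then have "(x, Suc x) \<in> parcs (heawood n)"
      by (auto simp: heawood_def heawood_arc_def)
    moreover have "0 \<rightarrow>\<^sup>*\<^bsub>?G\<^esub> x"
      using Suc by simp
    ultimately show ?case
      by (intro reachable_adj_trans[of 0 x "Suc x"]) simp_all
  qed
  have "u \<rightarrow>\<^sup>*\<^bsub>?G\<^esub> v" if "u < n" "v < n" for u v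
    using symmetric_reachable[OF pair_sym_arcs from0[OF that(1)]] from0[OF that(2)]
    by (rule reachable_trans)
  moreover have "verts ?G = {..<n}" "0 < n"
    using assms by (simp_all add: heawood_def)
  ultimately show ?thesis
    by (intro connectedI reachable_mk_symmetricI) auto
qed

section \<open>The spectrum\<close>

theorem mainTheorem1:
  shows "kg_spectrum 3 6 = {n. even n \<and> 14 \<le> n}
       \<and> (LEAST n. n \<in> kg_spectrum 3 6) = 14
       \<and> spectrum_N 3 6 = 14
       \<and> moore_bound 3 6 = 14"
proof -
  have spectrum: "kg_spectrum 3 6 = {n. even n \<and> 14 \<le> n}"
  proof (intro equalityI subsetI)
    fix n assume "n \<in> kg_spectrum 3 6"
    then obtain G :: "nat pair_pre_digraph" where G: "pair_graph G" "regular 3 G" "6 \<le> girth G"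
      and conn: "Digraph_Component.connected (with_proj G)" and n: "card (pverts G) = n"
      by (auto simp: kg_spectrum_def kg_graph_def numeral_eq_enat)
    from conn have "pverts G \<noteq> {}"
      by (auto simp: connected_def strongly_connected_def)
    then have "14 \<le> n"
      using order_ge_if_girth_ge_6[OF G] n by simp
    moreover have "even n"
      using regular_imp_even_mult_card[OF G(1,2)] n by simp
    ultimately show "n \<in> {n. even n \<and> 14 \<le> n}" by simp
  next
    fix n :: nat assume "n \<in> {n. even n \<and> 14 \<le> n}"
    then have "even n" "14 \<le> n" by auto
    then have "kg_graph 3 6 (heawood n)"
      by (simp add: kg_graph_def pair_graph_heawood regular_heawood girth_heawood numeral_eq_enat)
    moreover have "card (pverts (heawood n)) = n"
      by (simp add: heawood_def)
    ultimately show "n \<in> kg_spectrum 3 6"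
      using connected_heawood[OF \<open>14 \<le> n\<close>] by (auto simp: kg_spectrum_def)
  qed
  moreover have "(LEAST n. n \<in> kg_spectrum 3 6) = 14"
    unfolding spectrum by (rule Least_equality) auto
  moreover have "spectrum_N 3 6 = 14"
    unfolding spectrum_N_def spectrum by (rule Least_equality) auto
  moreover have "moore_bound 3 6 = 14"
    by (simp add: moore_bound_def atLeastAtMost_upt upt_rec)
  ultimately show ?thesis by blast
qed

end
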